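(* Let $1\le k\le n$ be integers and let $A\in\mathbb{R}^{n\times n}$ be a (symmetric positive semidefinite) sample covariance matrix. Define $$\lambda^k(A)=\max\{x^\top A x:\ x\in\mathbb{R}^n,\ \|x\|_2=1,\ \|x\|_0\le k\},\qquad \mathrm{OPT}_{\ell_1}=\max\{x^\top A x:\ x\in\mathbb{R}^n,\ \|x\|_2\le 1,\ \|x\|_1\le\sqrt{k}\}.$$ Then there is a real number $\rho$ with $0\le \rho\le 1+\sqrt{\frac{k}{k+1}}$ such that $$\lambda^k(A)\ \le\ \mathrm{OPT}_{\ell_1}\ \le\ \rho^2\cdot\lambda^k(A).$$
   Context: $\|x\|_0$ denotes the number of nonzero components of $x$, and $\|x\|_1,\|x\|_2$ are the usual $\ell_1$ and $\ell_2$ norms. A sample covariance matrix is a matrix of the form $A=\frac1m Y^\top Y$ with $Y\in\mathbb{R}^{m\times n}$. *)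

theory Defs
  imports "HOL-Analysis.Analysis"
begin

definition l0_norm :: "real ^ 'n \<Rightarrow> nat" where
  "l0_norm x = card {i. x $ i \<noteq> 0}"

definition l1_norm :: "real ^ 'n \<Rightarrow> real" where
  "l1_norm x = (\<Sum>i\<in>UNIV. \<bar>x $ i\<bar>)"

text \<open>The data matrix has \<open>m = CARD('m)\<close> rows (samples) and \<open>n = CARD('n)\<close> columns (variables).\<close>

definition sample_covariance :: "real ^ 'n ^ 'm \<Rightarrow> real ^ 'n ^ 'n" where
  "sample_covariance Y = (1 / real CARD('m)) *\<^sub>R (transpose Y ** Y)"

text \<open>
  \<open>Greatest\<close> is a maximum rather than a supremum: it is only specified when the maximum is
  attained. The lemmas \<open>sparse_eigenvalue_attained\<close> and \<open>opt_l1_attained\<close> below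
  show that this is the case.
\<close>

definition sparse_eigenvalue :: "nat \<Rightarrow> real ^ 'n ^ 'n \<Rightarrow> real" where
  "sparse_eigenvalue k A =
     (GREATEST v. \<exists>x. v = x \<bullet> (A *v x) \<and> norm x = 1 \<and> l0_norm x \<le> k)"

definition opt_l1 :: "nat \<Rightarrow> real ^ 'n ^ 'n \<Rightarrow> real" where
  "opt_l1 k A =
     (GREATEST v. \<exists>x. v = x \<bullet> (A *v x) \<and> norm x \<le> 1 \<and> l1_norm x \<le> sqrt (real k))"

lemma Greatest_quadratic_form:
  fixes A :: "real ^ 'n ^ 'n"
  assumes "compact {x. P x}" and "P y"
  shows "\<exists>x. P x \<and> (GREATEST v. \<exists>x. v = x \<bullet> (A *v x) \<and> P x) = x \<bullet> (A *v x)
           \<and> (\<forall>z. P z \<longrightarrow> z \<bullet> (A *v z) \<le> x \<bullet> (A *v x))"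
proof -
  have "continuous_on {x. P x} (\<lambda>x. x \<bullet> (A *v x))"
    by (intro continuous_intros matrix_vector_mult_linear_continuous_on)
  then obtain x where x: "P x" "\<forall>z. P z \<longrightarrow> z \<bullet> (A *v z) \<le> x \<bullet> (A *v x)"
    using continuous_attains_sup[of "{x. P x}" "\<lambda>x. x \<bullet> (A *v x)"] assms by auto
  then have "(GREATEST v. \<exists>x. v = x \<bullet> (A *v x) \<and> P x) = x \<bullet> (A *v x)"
    by (intro Greatest_equality) auto
  with x show ?thesis by blast
qed

lemma closed_l0_norm_le: "closed {x :: real ^ 'n. l0_norm x \<le> k}"
proof -
  have "{x :: real ^ 'n. l0_norm x \<le> k} =
      (\<Union>S\<in>{S. card S \<le> k}. {x. \<forall>i. i \<notin> S \<longrightarrow> x $ i = 0})"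
  proof (intro set_eqI iffI)
    fix x :: "real ^ 'n"
    assume "x \<in> {x. l0_norm x \<le> k}"
    then show "x \<in> (\<Union>S\<in>{S. card S \<le> k}. {x. \<forall>i. i \<notin> S \<longrightarrow> x $ i = 0})"
      by (auto simp: l0_norm_def intro!: exI[of _ "{i. x $ i \<noteq> 0}"])
  next
    fix x :: "real ^ 'n"
    assume "x \<in> (\<Union>S\<in>{S. card S \<le> k}. {x. \<forall>i. i \<notin> S \<longrightarrow> x $ i = 0})"
    then obtain S where S: "card S \<le> k" "\<forall>i. i \<notin> S \<longrightarrow> x $ i = 0" by auto
    then have "{i. x $ i \<noteq> 0} \<subseteq> S" by auto
    then have "card {i. x $ i \<noteq> 0} \<le> card S" by (intro card_mono) auto
    with S show "x \<in> {x. l0_norm x \<le> k}" by (simp add: l0_norm_def)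
  qed
  moreover have "closed {x :: real ^ 'n. \<forall>i. i \<notin> S \<longrightarrow> x $ i = 0}" for S
    by (intro closed_Collect_all closed_Collect_imp closed_Collect_eq open_Collect_const
        continuous_intros)
  ultimately show ?thesis by (auto intro!: closed_UN)
qed

lemma sparse_eigenvalue_attained:
  fixes A :: "real ^ 'n ^ 'n"
  assumes "1 \<le> k"
  shows "\<exists>x. norm x = 1 \<and> l0_norm x \<le> k \<and> sparse_eigenvalue k A = x \<bullet> (A *v x)
           \<and> (\<forall>z. norm z = 1 \<and> l0_norm z \<le> k \<longrightarrow> z \<bullet> (A *v z) \<le> x \<bullet> (A *v x))"
proof -
  have "{x :: real ^ 'n. norm x = 1 \<and> l0_norm x \<le> k} = sphere 0 1 \<inter> {x. l0_norm x \<le> k}"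
    by auto
  then have "compact {x :: real ^ 'n. norm x = 1 \<and> l0_norm x \<le> k}"
    by (simp add: closed_l0_norm_le compact_Int_closed)
  moreover have "norm (axis i 1 :: real ^ 'n) = 1 \<and> l0_norm (axis i 1 :: real ^ 'n) \<le> k" for i
    using assms by (simp add: l0_norm_def axis_def norm_axis_1[unfolded axis_def])
  ultimately show ?thesis
    using Greatest_quadratic_form[of "\<lambda>x. norm x = 1 \<and> l0_norm x \<le> k" _ A]
    unfolding sparse_eigenvalue_def by blast
qed

lemma opt_l1_attained:
  fixes A :: "real ^ 'n ^ 'n"
  shows "\<exists>x. norm x \<le> 1 \<and> l1_norm x \<le> sqrt (real k) \<and> opt_l1 k A = x \<bullet> (A *v x)
           \<and> (\<forall>z. norm z \<le> 1 \<and> l1_norm z \<le> sqrt (real k) \<longrightarrow> z \<bullet> (A *v z) \<le> x \<bullet> (A *v x))"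
proof -
  have "{x :: real ^ 'n. norm x \<le> 1 \<and> l1_norm x \<le> sqrt (real k)}
      = cball 0 1 \<inter> {x. l1_norm x \<le> sqrt (real k)}"
    by auto
  moreover have "closed {x :: real ^ 'n. l1_norm x \<le> sqrt (real k)}"
    unfolding l1_norm_def by (intro closed_Collect_le continuous_intros)
  ultimately have "compact {x :: real ^ 'n. norm x \<le> 1 \<and> l1_norm x \<le> sqrt (real k)}"
    by (simp add: compact_Int_closed)
  moreover have "norm (0 :: real ^ 'n) \<le> 1 \<and> l1_norm (0 :: real ^ 'n) \<le> sqrt (real k)"
    by (simp add: l1_norm_def)
  ultimately show ?thesis
    using Greatest_quadratic_form[of "\<lambda>x. norm x \<le> 1 \<and> l1_norm x \<le> sqrt (real k)" 0 A]
    unfolding opt_l1_def by blast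
qed

end

theory Submission
  imports Defs
begin

text \<open>
  The constant \<open>\<rho> = sqrt 2\<close> works for every \<open>k\<close>, since \<open>sqrt 2 \<le> 1 + sqrt (1/2)\<close> and
  \<open>k / (k + 1) \<ge> 1/2\<close>.

  The bound \<open>\<lambda> \<le> OPT\<close>, writing \<open>\<lambda>\<close> for the sparse optimum and \<open>OPT\<close> for the \<open>\<ell>\<^sub>1\<close> optimum,
  holds because a unit vector with at most \<open>k\<close> nonzero entries has
  \<open>\<ell>\<^sub>1\<close> norm at most \<open>sqrt k\<close> (\<open>l1_norm_le_sqrt_l0_norm\<close>), so that the \<open>\<ell>\<^sub>1\<close> problem is a
  relaxation of the sparse one.

  For \<open>OPT \<le> 2 * \<lambda>\<close>, let \<open>x\<close> be optimal for the \<open>\<ell>\<^sub>1\<close> problem, put \<open>c = A x\<close>, and let \<open>T\<close>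
  be a set of \<open>k\<close> coordinates where \<open>c\<close> is largest in absolute value. Two estimates of linear
  functionals are combined.

  On the one hand, \<open>x \<bullet> c \<le> sqrt 2 * N\<close>, where \<open>N\<close> is the Euclidean norm of the restriction of
  \<open>c\<close> to \<open>T\<close> (\<open>inner_le_sqrt2_top_norm\<close>). To see this, truncate \<open>c\<close> at the level \<open>t\<close> of the
  smallest entry in \<open>T\<close>: the truncated part pairs with \<open>x\<close> to at most \<open>t * sqrt k\<close> by the
  \<open>\<ell>\<^sub>1\<close> bound, the excess (supported on \<open>T\<close>, of norm \<open>U\<close>) to at most \<open>U\<close> by the \<open>\<ell>\<^sub>2\<close> bound,
  and \<open>U\<^sup>2 + k * t\<^sup>2 \<le> N\<^sup>2\<close>.

  On the other hand, if \<open>N \<noteq> 0\<close>, the normalised restriction \<open>z\<close> of \<open>c\<close> to \<open>T\<close> is feasible for the sparse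
  problem and \<open>N = z \<bullet> A x\<close>. As \<open>A\<close> is a Gram matrix, Cauchy-Schwarz gives
  \<open>N\<^sup>2 \<le> (z \<bullet> A z) * (x \<bullet> A x)\<close>. Hence \<open>OPT\<^sup>2 \<le> 2 * N\<^sup>2 \<le> 2 * \<lambda> * OPT\<close>; if \<open>N = 0\<close>,
  then \<open>OPT = 0\<close> already. Applying
  Cauchy-Schwarz to the quadratic form in this way replaces a decomposition of \<open>x\<close> into a
  convex combination of sparse vectors.
\<close>

lemma L2_set_le_norm: "L2_set (($) x) S \<le> norm x"
  for x :: "real ^ 'n"
  unfolding norm_vec_def L2_set_def by (auto intro!: real_sqrt_le_mono sum_mono2)

lemma l1_norm_le_sqrt_l0_norm: "l1_norm x \<le> sqrt (real (l0_norm x)) * norm x"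
proof -
  let ?S = "{i. x $ i \<noteq> 0}"
  have "l1_norm x = (\<Sum>i\<in>?S. \<bar>1\<bar> * \<bar>x $ i\<bar>)"
    unfolding l1_norm_def by (simp, rule sum.mono_neutral_right) auto
  also have "\<dots> \<le> L2_set (\<lambda>_. 1) ?S * L2_set (($) x) ?S"
    by (rule L2_set_mult_ineq)
  also have "\<dots> \<le> sqrt (real (l0_norm x)) * norm x"
    by (rule mult_mono[OF _ L2_set_le_norm]) (auto simp: L2_set_def l0_norm_def sum_nonneg)
  finally show ?thesis .
qed

lemma ex_largest_entries:
  fixes f :: "'a::finite \<Rightarrow> 'b::linorder"
  assumes "k \<le> CARD('a)"
  shows "\<exists>T. card T = k \<and> (\<forall>i\<in>T. \<forall>j. j \<notin> T \<longrightarrow> f j \<le> f i)"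
  using assms
proof (induction k)
  case 0
  show ?case by (intro exI[of _ "{}"]) simp
next
  case (Suc k)
  then obtain T where T: "card T = k" "\<forall>i\<in>T. \<forall>j. j \<notin> T \<longrightarrow> f j \<le> f i"
    by auto
  have "- T \<noteq> {}"
    using T(1) Suc.prems by (metis Compl_empty_eq double_compl not_less_eq_eq order_refl)
  then have "Max (f ` (- T)) \<in> f ` (- T)" by (intro Max_in) auto
  then obtain m where m: "m \<notin> T" "f m = Max (f ` (- T))" by fastforce
  have "f j \<le> f m" if "j \<notin> T" for j
    using that m(2) by simp
  with T m(1) show ?case
    by (intro exI[of _ "insert m T"]) auto
qed

text \<open>
  The entries of \<open>c\<close> are split at the threshold \<open>t\<close>, the smallest absolute value on \<open>T\<close>; each
  of the two parts is paired with \<open>x\<close> through the norm constraint that suits it.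
\<close>

lemma inner_le_sqrt2_top_norm:
  fixes c x :: "real ^ 'n"
  assumes T: "card T = k" "\<forall>i\<in>T. \<forall>j. j \<notin> T \<longrightarrow> \<bar>c $ j\<bar> \<le> \<bar>c $ i\<bar>" and k: "1 \<le> k"
    and x: "norm x \<le> 1" "l1_norm x \<le> sqrt (real k)"
  shows "x \<bullet> c \<le> sqrt 2 * L2_set (($) c) T"
proof -
  define t where "t = Min ((\<lambda>i. \<bar>c $ i\<bar>) ` T)"
  define U where "U = L2_set (\<lambda>i. \<bar>c $ i\<bar> - t) T"
  define N where "N = L2_set (($) c) T"
  have "T \<noteq> {}" using T(1) k by auto
  then have "t \<in> (\<lambda>i. \<bar>c $ i\<bar>) ` T" unfolding t_def by (intro Min_in) auto
  then obtain i0 where i0: "i0 \<in> T" "t = \<bar>c $ i0\<bar>" by auto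
  have t0: "0 \<le> t" using i0 by simp
  have le_t: "\<bar>c $ j\<bar> \<le> t" if "j \<notin> T" for j using that T(2) i0 by auto
  have t_le: "t \<le> \<bar>c $ i\<bar>" if "i \<in> T" for i using that unfolding t_def by simp

  have "x \<bullet> c \<le> (\<Sum>i\<in>UNIV. (if i \<in> T then (\<bar>c $ i\<bar> - t) * \<bar>x $ i\<bar> else 0) + t * \<bar>x $ i\<bar>)"
    unfolding inner_vec_def
  proof (rule sum_mono)
    fix i
    have "x $ i \<bullet> c $ i \<le> \<bar>c $ i\<bar> * \<bar>x $ i\<bar>"
      by (metis abs_ge_self abs_mult inner_real_def mult.commute)
    also have "\<dots> \<le> (if i \<in> T then (\<bar>c $ i\<bar> - t) * \<bar>x $ i\<bar> else 0) + t * \<bar>x $ i\<bar>"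
      using le_t[of i] by (auto simp: left_diff_distrib mult_right_mono)
    finally show "x $ i \<bullet> c $ i \<le> \<dots>" .
  qed
  also have "\<dots> = (\<Sum>i\<in>T. (\<bar>c $ i\<bar> - t) * \<bar>x $ i\<bar>) + t * l1_norm x"
    by (simp add: sum.distrib sum_distrib_left l1_norm_def flip: sum.inter_restrict)
  also have "\<dots> \<le> U + t * sqrt k"
  proof (rule add_mono)
    have "(\<Sum>i\<in>T. (\<bar>c $ i\<bar> - t) * \<bar>x $ i\<bar>) \<le> (\<Sum>i\<in>T. \<bar>\<bar>c $ i\<bar> - t\<bar> * \<bar>x $ i\<bar>)"
      by (intro sum_mono mult_right_mono) auto
    also have "\<dots> \<le> U * L2_set (($) x) T"
      unfolding U_def by (rule L2_set_mult_ineq)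
    also have "\<dots> \<le> U * 1"
      using L2_set_le_norm[of x T] x(1) by (intro mult_left_mono) (auto simp: U_def)
    finally show "(\<Sum>i\<in>T. (\<bar>c $ i\<bar> - t) * \<bar>x $ i\<bar>) \<le> U" by simp
    show "t * l1_norm x \<le> t * sqrt k" using x(2) t0 by (rule mult_left_mono)
  qed
  also have "\<dots> \<le> sqrt 2 * N"
  proof (rule power2_le_imp_le)
    have "U\<^sup>2 + k * t\<^sup>2 = (\<Sum>i\<in>T. (\<bar>c $ i\<bar> - t)\<^sup>2 + t\<^sup>2)"
      using T(1) by (simp add: U_def L2_set_def sum.distrib sum_nonneg)
    also have "\<dots> \<le> (\<Sum>i\<in>T. (c $ i)\<^sup>2)"
    proof (rule sum_mono)
      fix i assume "i \<in> T"
      \<comment> \<open>The cross term \<open>2 * t * (\<bar>c $ i\<bar> - t)\<close> is nonnegative on \<open>T\<close>.\<close>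
      then have "0 \<le> t * (\<bar>c $ i\<bar> - t)" using t_le t0 by simp
      then show "(\<bar>c $ i\<bar> - t)\<^sup>2 + t\<^sup>2 \<le> (c $ i)\<^sup>2"
        using power2_abs[of "c $ i"] by (simp add: power2_eq_square algebra_simps)
    qed
    also have "\<dots> = N\<^sup>2" by (simp add: N_def L2_set_def sum_nonneg)
    finally have "U\<^sup>2 + (t * sqrt k)\<^sup>2 \<le> N\<^sup>2" by (simp add: power_mult_distrib mult.commute)
    moreover have "(U + t * sqrt k)\<^sup>2 \<le> 2 * (U\<^sup>2 + (t * sqrt k)\<^sup>2)"
      using zero_le_power2[of "U - t * sqrt k"] by (simp add: power2_sum power2_diff)
    ultimately show "(U + t * sqrt k)\<^sup>2 \<le> (sqrt 2 * N)\<^sup>2"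
      by (simp add: power_mult_distrib)
  qed (simp add: N_def)
  finally show ?thesis by (simp add: N_def)
qed

lemma inner_sample_covariance:
  fixes Y :: "real ^ 'n ^ 'm"
  shows "x \<bullet> (sample_covariance Y *v z) = ((Y *v x) \<bullet> (Y *v z)) / real CARD('m)"
proof -
  have "x \<bullet> (transpose Y *v (Y *v z)) = (Y *v x) \<bullet> (Y *v z)"
    by (metis dot_lmul_matrix inner_commute transpose_matrix_vector)
  then show ?thesis
    by (simp add: sample_covariance_def scaleR_matrix_vector_assoc[symmetric]
        matrix_vector_mul_assoc[symmetric])
qed

text \<open>
  The form factors through \<open>x \<mapsto> Y x\<close>, so this is Cauchy-Schwarz for \<open>Y z\<close> and \<open>Y x\<close>.
\<close>

lemma sample_covariance_Cauchy_Schwarz: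
  fixes x z :: "real ^ 'n" and Y :: "real ^ 'n ^ 'm"
  defines "A \<equiv> sample_covariance Y"
  shows "(z \<bullet> (A *v x))\<^sup>2 \<le> (z \<bullet> (A *v z)) * (x \<bullet> (A *v x))"
  using Cauchy_Schwarz_ineq[of "Y *v z" "Y *v x"]
  by (simp add: A_def inner_sample_covariance power_divide power2_eq_square divide_right_mono)

theorem theorem1:
  fixes A :: "real ^ 'n ^ 'n" and Y :: "real ^ 'n ^ 'm" and k :: nat
  assumes "1 \<le> k" and "k \<le> CARD('n)"
    and "A = sample_covariance Y"
  shows "\<exists>\<rho>::real. 0 \<le> \<rho> \<and> \<rho> \<le> 1 + sqrt (real k / (real k + 1))
           \<and> sparse_eigenvalue k A \<le> opt_l1 k A
           \<and> opt_l1 k A \<le> \<rho>\<^sup>2 * sparse_eigenvalue k A"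
proof (intro exI[of _ "sqrt 2"] conjI)
  obtain x where x: "norm x \<le> 1" "l1_norm x \<le> sqrt k" "opt_l1 k A = x \<bullet> (A *v x)"
      and x_max: "\<And>z. norm z \<le> 1 \<Longrightarrow> l1_norm z \<le> sqrt k \<Longrightarrow> z \<bullet> (A *v z) \<le> opt_l1 k A"
    using opt_l1_attained[of k A] by auto
  obtain y where y: "norm y = 1" "l0_norm y \<le> k" "sparse_eigenvalue k A = y \<bullet> (A *v y)"
      and y_max: "\<And>z. norm z = 1 \<Longrightarrow> l0_norm z \<le> k \<Longrightarrow> z \<bullet> (A *v z) \<le> sparse_eigenvalue k A"
    using sparse_eigenvalue_attained[OF assms(1), of A] by auto
  have psd: "0 \<le> z \<bullet> (A *v z)" for z
    by (simp add: assms(3) inner_sample_covariance)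

  show "0 \<le> sqrt (2::real)" by simp

  show "sqrt 2 \<le> 1 + sqrt (real k / (real k + 1))"
  proof -
    have "1 / 2 \<le> real k / (real k + 1)" using assms(1) by (simp add: field_simps)
    then have "sqrt (1 / 2) \<le> sqrt (real k / (real k + 1))" by (rule real_sqrt_le_mono)
    moreover have "sqrt 2 / 2 = sqrt (1 / 2)"
      by (simp add: real_sqrt_divide field_simps)
    moreover have "sqrt 2 \<le> (2::real)" by (rule real_le_lsqrt) auto
    ultimately show ?thesis by linarith
  qed

  show "sparse_eigenvalue k A \<le> opt_l1 k A"
  proof -
    have "l1_norm y \<le> sqrt (real (l0_norm y))"
      using l1_norm_le_sqrt_l0_norm[of y] y(1) by simp
    also have "\<dots> \<le> sqrt k" using y(2) by simp
    finally show ?thesis using x_max[of y] y by simp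
  qed

  show "opt_l1 k A \<le> (sqrt 2)\<^sup>2 * sparse_eigenvalue k A"
  proof -
    define c where "c = A *v x"
    obtain T where T: "card T = k" "\<forall>i\<in>T. \<forall>j. j \<notin> T \<longrightarrow> \<bar>c $ j\<bar> \<le> \<bar>c $ i\<bar>"
      using ex_largest_entries[OF assms(2), of "\<lambda>i. \<bar>c $ i\<bar>"] by auto
    define N where "N = L2_set (($) c) T"
    have N2: "N\<^sup>2 = (\<Sum>i\<in>T. (c $ i)\<^sup>2)" by (simp add: N_def L2_set_def sum_nonneg)
    have opt_le: "opt_l1 k A \<le> sqrt 2 * N"
      using inner_le_sqrt2_top_norm[OF T assms(1) x(1,2)] x(3) by (simp add: c_def N_def)
    show ?thesis
    proof (cases "opt_l1 k A = 0")
      case True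
      then show ?thesis using psd[of y] y(3) by simp
    next
      case False
      then have opt_pos: "0 < opt_l1 k A" using psd[of x] x(3) by simp
      then have "0 < sqrt 2 * N" using opt_le by linarith
      then have N_pos: "0 < N" by (simp add: zero_less_mult_iff)
      \<comment> \<open>\<open>z\<close> maximises \<open>z \<bullet> c\<close> among the unit vectors supported on \<open>T\<close>.\<close>
      define z :: "real ^ 'n" where "z = (\<chi> i. if i \<in> T then c $ i / N else 0)"
      have "(norm z)\<^sup>2 = (\<Sum>i\<in>T. (c $ i / N)\<^sup>2)"
        by (simp add: norm_vec_def L2_set_def sum_nonneg z_def if_distrib[of "\<lambda>a. a\<^sup>2"]
            flip: sum.inter_restrict cong: if_cong)
      also have "\<dots> = 1"
        using N_pos by (simp add: power_divide flip: sum_divide_distrib N2)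
      finally have z_norm: "norm z = 1" using power2_eq_imp_eq[of "norm z" 1] by simp
      have "{i. z $ i \<noteq> 0} \<subseteq> T" by (auto simp: z_def)
      then have z_sparse: "l0_norm z \<le> k"
        using card_mono[of T] T(1) by (auto simp: l0_norm_def)
      have "z \<bullet> c = (\<Sum>i\<in>T. c $ i / N * c $ i)"
        by (simp add: inner_vec_def z_def if_distrib[of "\<lambda>a. a * _"]
            flip: sum.inter_restrict cong: if_cong)
      also have "\<dots> = N"
        using N_pos N2 by (simp add: field_simps power2_eq_square flip: sum_divide_distrib)
      finally have "N\<^sup>2 \<le> (z \<bullet> (A *v z)) * opt_l1 k A"
        using sample_covariance_Cauchy_Schwarz[of z Y x] x(3) by (simp add: assms(3) c_def)
      also have "\<dots> \<le> sparse_eigenvalue k A * opt_l1 k A"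
        using y_max[OF z_norm z_sparse] opt_pos by (intro mult_right_mono) auto
      finally have "2 * N\<^sup>2 \<le> 2 * sparse_eigenvalue k A * opt_l1 k A" by simp
      moreover have "(opt_l1 k A)\<^sup>2 \<le> 2 * N\<^sup>2"
        using power_mono[OF opt_le, of 2] opt_pos by (simp add: power_mult_distrib)
      ultimately have "opt_l1 k A * opt_l1 k A \<le> 2 * sparse_eigenvalue k A * opt_l1 k A"
        by (simp add: power2_eq_square)
      then show ?thesis using opt_pos by simp
    qed
  qed
qed

end
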